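(* The field $\mathbb{K}$ of generalised Puiseux series over $\mathbb{C}$ is algebraically closed.
   Context: Let $\mathbb{M}$ be the collection of all subsets $A\subset\mathbb{R}$ such that either $A$ is finite (possibly empty), or $A=\{\alpha_n \mid n\in\mathbb{N}\}$ for some strictly increasing, unbounded sequence $(\alpha_n)_{n\in\mathbb{N}}$ of real numbers. For $A\in\mathbb{M}$ and $a_\alpha\in\mathbb{C}^*=\mathbb{C}\setminus\{0\}$ for $\alpha\in A$, the symbol $\sum_{\alpha\in A}a_\alpha\cdot t^\alpha$ denotes the function $f:\mathbb{R}\to\mathbb{C}$ with $f(\alpha)=a_\alpha$ if $\alpha\in A$ and $f(\alpha)=0$ otherwise. The set of generalised Puiseux series is $$\mathbb{K}=\Big\{\sum_{\alpha\in A}a_\alpha\cdot t^\alpha \;\Big|\; A\in\mathbb{M},\ a_\alpha\in\mathbb{C}^*\Big\},$$ i.e. the set of all functions $f:\mathbb{R}\to\mathbb{C}$ whose support $\{\alpha\in\mathbb{R}\mid f(\alpha)\neq 0\}$ belongs to $\mathbb{M}$ (the zero function is included, with $A=\emptyset$). For $f=\sum_{\alpha\in A}a_\alpha t^\alpha$ and $g=\sum_{\beta\in B}b_\beta t^\beta$ in $\mathbb{K}$, addition is pointwise, $(f+g)(\alpha)=f(\alpha)+g(\alpha)$, and multiplication is $$f\cdot g=\sum_{\gamma\in A*B}\Big(\sum_{\alpha\in A,\ \beta\in B,\ \alpha+\beta=\gamma}a_\alpha b_\beta\Big)\cdot t^\gamma,\qquad A*B=\{\alpha+\beta\mid\alpha\in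 A,\ \beta\in B\},$$ where coefficients in such an expression are allowed to be zero, and for each $\gamma$ the inner sum is finite. With these operations $\mathbb{K}$ is a field. *)

theory Defs
  imports Complex_Main "HOL-Algebra.Algebraic_Closure"
begin

definition puiseux_supports :: "real set set" where
  "puiseux_supports =
     {A. finite A \<or> (\<exists>a :: nat \<Rightarrow> real. strict_mono a \<and> \<not> Bseq a \<and> A = range a)}"

definition gen_puiseux_series :: "(real \<Rightarrow> complex) set" where
  "gen_puiseux_series = {f. {\<alpha>. f \<alpha> \<noteq> 0} \<in> puiseux_supports}"

text \<open>
  A sum over an infinite index set is \<open>0\<close> by convention; for factors in
  \<^const>\<open>gen_puiseux_series\<close> the index set is always finite, see
  \<open>finite_puiseux_mult_index\<close> below. For \<open>\<gamma>\<close> outside the sumset of the two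
  supports the index set is empty.
\<close>
definition puiseux_mult :: "(real \<Rightarrow> complex) \<Rightarrow> (real \<Rightarrow> complex) \<Rightarrow> real \<Rightarrow> complex" where
  "puiseux_mult f g =
     (\<lambda>\<gamma>. \<Sum>(\<alpha>, \<beta>) \<in> {(\<alpha>, \<beta>). f \<alpha> \<noteq> 0 \<and> g \<beta> \<noteq> 0 \<and> \<alpha> + \<beta> = \<gamma>}. f \<alpha> * g \<beta>)"

definition gen_puiseux_ring :: "(real \<Rightarrow> complex) ring" where
  "gen_puiseux_ring =
     \<lparr>carrier = gen_puiseux_series,
      monoid.mult = puiseux_mult,
      one = (\<lambda>\<gamma>. if \<gamma> = 0 then 1 else 0),
      zero = (\<lambda>_. 0),
      add = (\<lambda>f g \<gamma>. f \<gamma> + g \<gamma>)\<rparr>"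

lemma finite_puiseux_support_atMost:
  assumes "A \<in> puiseux_supports"
  shows "finite (A \<inter> {..x})"
proof (cases "finite A")
  case False
  then obtain a :: "nat \<Rightarrow> real" where a: "strict_mono a" "\<not> Bseq a" "A = range a"
    using assms by (auto simp: puiseux_supports_def)
  have "\<exists>N. x < a N"
  proof (rule ccontr)
    assume "\<not> (\<exists>N. x < a N)"
    then have up: "a n \<le> x" for n
      by (meson not_le)
    have low: "a 0 \<le> a n" for n
      using strict_mono_mono[OF a(1)] by (simp add: monoD)
    have "norm (a n) \<le> \<bar>a 0\<bar> + \<bar>x\<bar>" for n
      using up[of n] low[of n] by (simp add: abs_if)
    then have "Bseq a"
      by (rule BseqI')
    with a(2) show False ..
  qed
  then obtain N where N: "x < a N" ..
  have "A \<inter> {..x} \<subseteq> a ` {..N}"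
  proof
    fix y assume "y \<in> A \<inter> {..x}"
    then obtain n where n: "y = a n" "a n \<le> x"
      using a(3) by auto
    with N have "a n < a N" by simp
    then have "n < N"
      using a(1) by (simp add: strict_mono_less)
    with n show "y \<in> a ` {..N}" by simp
  qed
  then show ?thesis
    by (rule finite_subset) simp
qed simp

lemma puiseux_support_lower_bound:
  assumes "A \<in> puiseux_supports"
  shows "\<exists>m. \<forall>\<alpha>\<in>A. m \<le> \<alpha>"
proof (cases "finite A")
  case True
  then show ?thesis
    using bdd_below_finite[of A] by (auto simp: bdd_below_def)
next
  case False
  then obtain a :: "nat \<Rightarrow> real" where a: "strict_mono a" "A = range a"
    using assms by (auto simp: puiseux_supports_def)
  have "\<forall>\<alpha>\<in>A. a 0 \<le> \<alpha>"
    using strict_mono_mono[OF a(1)] by (auto simp: a(2) monoD)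
  then show ?thesis ..
qed

lemma finite_puiseux_mult_index:
  assumes f: "f \<in> gen_puiseux_series" and g: "g \<in> gen_puiseux_series"
  shows "finite {(\<alpha>, \<beta>). f \<alpha> \<noteq> 0 \<and> g \<beta> \<noteq> 0 \<and> \<alpha> + \<beta> = \<gamma>}"
proof -
  have A: "{\<alpha>. f \<alpha> \<noteq> 0} \<in> puiseux_supports" and B: "{\<beta>. g \<beta> \<noteq> 0} \<in> puiseux_supports"
    using f g by (simp_all add: gen_puiseux_series_def)
  obtain m where m: "\<And>\<beta>. g \<beta> \<noteq> 0 \<Longrightarrow> m \<le> \<beta>"
    using puiseux_support_lower_bound[OF B] by auto
  have "{(\<alpha>, \<beta>). f \<alpha> \<noteq> 0 \<and> g \<beta> \<noteq> 0 \<and> \<alpha> + \<beta> = \<gamma>}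
      \<subseteq> (\<lambda>\<alpha>. (\<alpha>, \<gamma> - \<alpha>)) ` ({\<alpha>. f \<alpha> \<noteq> 0} \<inter> {..\<gamma> - m})"
    using m by (force simp: image_iff)
  then show ?thesis
    using finite_puiseux_support_atMost[OF A] finite_subset by blast
qed

end

theory Submission
  imports
    Defs
    "HOL-Computational_Algebra.Computational_Algebra"
    "HOL-Computational_Algebra.Field_as_Ring"
begin

text \<open>
  The proof is the Newton-Puiseux argument, in a form that produces factorizations instead of
  roots. A field of characteristic zero is algebraically closed as soon as every monic polynomial
  \<open>p\<close> of degree \<open>n > 1\<close> with vanishing coefficient at \<open>n - 1\<close> and nonzero constant term is
  reducible. For such a \<open>p\<close> over the generalised Puiseux series, a substitution
  \<open>X \<mapsto> t^\<rho> X\<close>, with \<open>\<rho>\<close> the smallest slope of the Newton polygon, makes all coefficients have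
  nonnegative order while some coefficient other than the leading one has order exactly \<open>0\<close>.
  Setting \<open>t = 0\<close> then gives a monic complex polynomial different from \<open>X^n\<close> whose coefficient at
  \<open>n - 1\<close> is zero. It cannot be a power of a linear polynomial, so over the complex numbers it is
  a product of two coprime nonconstant factors (\<open>depressed_poly_has_two_roots\<close>).

  By a form of Hensel's lemma (\<open>coprime_factorization_lifts\<close>) these factors lift to factors of
  the original polynomial. The correction terms are the fixed point of a contraction, and fixed
  points exist because the series are complete for the filtration by order
  (\<open>gpuiseux_complete\<close>). Two properties of the supports enter here: the exponents are locally
  finite, so that a series with positive exponents has order at least some \<open>\<epsilon> > 0\<close>, and
  multiples of \<open>\<epsilon>\<close> exceed every real exponent, so that orders growing by \<open>\<epsilon>\<close> in each step force
  every coefficient to become constant. The same completeness gives inverses, by the geometric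
  series.
\<close>

hide_const (open) Polynomials.degree Polynomials.lead_coeff UnivPoly.coeff UnivPoly.monom
  Divisibility.irreducible

section \<open>Locally finite supports and convolution\<close>

text \<open>
  With local finiteness in place of an enumeration, closure under unions and sumsets is a matter
  of counting. To enumerate an infinite locally finite set increasingly, send each element to its
  rank, the number of smaller elements: this is an order isomorphism onto the natural numbers
  because the set of ranks is infinite and closed under predecessors.
\<close>
lemma puiseux_supports_iff:
  "A \<in> puiseux_supports \<longleftrightarrow> (\<forall>x. finite (A \<inter> {..x}))"
proof
  assume "A \<in> puiseux_supports"
  then show "\<forall>x. finite (A \<inter> {..x})"
    using finite_puiseux_support_atMost by blast
next
  assume fin: "\<forall>x. finite (A \<inter> {..x})"
  show "A \<in> puiseux_supports"
  proof (cases "finite A")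
    case True
    then show ?thesis by (simp add: puiseux_supports_def)
  next
    case False
    define rank where "rank x = card (A \<inter> {..<x})" for x
    have finless: "finite (A \<inter> {..<x})" for x
      by (rule finite_subset[OF _ fin[rule_format, of x]]) auto
    have rank_less: "rank x < rank y" if "x \<in> A" "x < y" for x y
      unfolding rank_def by (rule psubset_card_mono[OF finless]) (use that in auto)
    have inj: "inj_on rank A"
      by (rule linorder_inj_onI') (metis less_irrefl rank_less)
    have down: "n \<in> rank ` A" if "Suc n \<in> rank ` A" for n
    proof -
      from that obtain y where y: "y \<in> A" "rank y = Suc n" by auto
      then have ne: "A \<inter> {..<y} \<noteq> {}"
        by (metis card.empty rank_def nat.distinct(1))
      define x where "x = Max (A \<inter> {..<y})"
      have x: "x \<in> A" "x < y"
        using Max_in[OF finless ne] by (auto simp: x_def)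
      have "A \<inter> {..<y} = insert x (A \<inter> {..<x})"
        using x Max_ge[OF finless, of _ y] by (fastforce simp: x_def[symmetric])
      then have "rank y = Suc (rank x)"
        by (simp add: rank_def finless)
      with y x show ?thesis by auto
    qed
    have down_le: "m \<in> rank ` A" if "n \<in> rank ` A" "m \<le> n" for m n
      using that(2,1) by (induction rule: inc_induct) (auto intro: down)
    have surj: "rank ` A = UNIV"
    proof -
      have "infinite (rank ` A)"
        using False inj by (simp add: finite_image_iff)
      then have "\<exists>n\<in>rank ` A. m \<le> n" for m
        by (meson infinite_nat_iff_unbounded_le)
      then show ?thesis
        using down_le by blast
    qed
    define a where "a = inv_into A rank"
    have a: "a n \<in> A" "rank (a n) = n" for n
      using surj by (auto simp: a_def inv_into_into f_inv_into_f)
    have mono: "strict_mono a"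
    proof (rule strict_monoI)
      fix m n :: nat assume "m < n"
      then show "a m < a n"
        by (metis a less_asym linorder_neqE rank_less)
    qed
    have ran: "A = range a"
      using a inj by (auto simp: inj_on_def) (metis a rangeI)
    have "\<not> Bseq a"
    proof
      assume "Bseq a"
      then obtain c where "\<And>n. norm (a n) \<le> c"
        by (auto simp: Bseq_def)
      then have "A \<inter> {..c} = A"
        by (force simp: ran abs_le_iff)
      with fin False show False by metis
    qed
    with mono ran show ?thesis
      by (auto simp: puiseux_supports_def)
  qed
qed

lemma mem_gen_puiseux_series_iff:
  "f \<in> gen_puiseux_series \<longleftrightarrow> (\<forall>x. finite {\<alpha>. \<alpha> \<le> x \<and> f \<alpha> \<noteq> 0})"
proof -
  have "{\<alpha>. f \<alpha> \<noteq> 0} \<inter> {..x} = {\<alpha>. \<alpha> \<le> x \<and> f \<alpha> \<noteq> 0}" for x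
    by auto
  then show ?thesis
    by (simp add: gen_puiseux_series_def puiseux_supports_iff)
qed

lemma gen_puiseux_series_lower_bound:
  assumes "f \<in> gen_puiseux_series"
  obtains m where "\<And>\<alpha>. f \<alpha> \<noteq> 0 \<Longrightarrow> m \<le> \<alpha>"
  using puiseux_support_lower_bound[of "{\<alpha>. f \<alpha> \<noteq> 0}"] assms that
  by (auto simp: gen_puiseux_series_def)

text \<open>
  The freedom in the index set \<open>A\<close> is what the ring laws are proved with: both sides of a law
  become sums over a common finite set, and it remains to exchange or split finite sums.
\<close>
lemma puiseux_mult_eq_sum:
  assumes "finite A" and "\<And>\<alpha>. f \<alpha> \<noteq> 0 \<Longrightarrow> g (\<gamma> - \<alpha>) \<noteq> 0 \<Longrightarrow> \<alpha> \<in> A"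
  shows "puiseux_mult f g \<gamma> = (\<Sum>\<alpha>\<in>A. f \<alpha> * g (\<gamma> - \<alpha>))"
proof -
  have "puiseux_mult f g \<gamma> = (\<Sum>\<alpha> | f \<alpha> \<noteq> 0 \<and> g (\<gamma> - \<alpha>) \<noteq> 0. f \<alpha> * g (\<gamma> - \<alpha>))"
    unfolding puiseux_mult_def
    by (rule sum.reindex_bij_witness[where i = "\<lambda>\<alpha>. (\<alpha>, \<gamma> - \<alpha>)" and j = fst]) auto
  also have "\<dots> = (\<Sum>\<alpha>\<in>A. f \<alpha> * g (\<gamma> - \<alpha>))"
    by (rule sum.mono_neutral_left) (use assms in auto)
  finally show ?thesis .
qed

lemma puiseux_mult_nonzeroE:
  assumes "puiseux_mult f g \<gamma> \<noteq> 0"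
  obtains \<alpha> \<beta> where "f \<alpha> \<noteq> 0" "g \<beta> \<noteq> 0" "\<alpha> + \<beta> = \<gamma>"
proof -
  have "{(\<alpha>, \<beta>). f \<alpha> \<noteq> 0 \<and> g \<beta> \<noteq> 0 \<and> \<alpha> + \<beta> = \<gamma>} \<noteq> {}"
    using assms unfolding puiseux_mult_def by (metis sum.empty)
  then show ?thesis using that by blast
qed

lemma puiseux_mult_commute: "puiseux_mult f g = puiseux_mult g f"
  unfolding puiseux_mult_def
  by (rule ext, rule sum.reindex_bij_witness[where i = prod.swap and j = prod.swap]) auto

lemma puiseux_mult_closed:
  assumes f: "f \<in> gen_puiseux_series" and g: "g \<in> gen_puiseux_series"
  shows "puiseux_mult f g \<in> gen_puiseux_series"
  unfolding mem_gen_puiseux_series_iff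
proof
  fix x
  obtain m where m: "\<And>\<alpha>. f \<alpha> \<noteq> 0 \<Longrightarrow> m \<le> \<alpha>"
    using gen_puiseux_series_lower_bound[OF f] by blast
  obtain k where k: "\<And>\<alpha>. g \<alpha> \<noteq> 0 \<Longrightarrow> k \<le> \<alpha>"
    using gen_puiseux_series_lower_bound[OF g] by blast
  let ?A = "{\<alpha>. \<alpha> \<le> x - k \<and> f \<alpha> \<noteq> 0}" and ?B = "{\<beta>. \<beta> \<le> x - m \<and> g \<beta> \<noteq> 0}"
  have "{\<gamma>. \<gamma> \<le> x \<and> puiseux_mult f g \<gamma> \<noteq> 0} \<subseteq> (\<lambda>(\<alpha>, \<beta>). \<alpha> + \<beta>) ` (?A \<times> ?B)"
  proof
    fix \<gamma> assume "\<gamma> \<in> {\<gamma>. \<gamma> \<le> x \<and> puiseux_mult f g \<gamma> \<noteq> 0}"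
    then have "\<gamma> \<le> x" and nz: "puiseux_mult f g \<gamma> \<noteq> 0" by auto
    from nz obtain \<alpha> \<beta> where ab: "f \<alpha> \<noteq> 0" "g \<beta> \<noteq> 0" "\<alpha> + \<beta> = \<gamma>"
      by (rule puiseux_mult_nonzeroE)
    with \<open>\<gamma> \<le> x\<close> m[of \<alpha>] k[of \<beta>] have "(\<alpha>, \<beta>) \<in> ?A \<times> ?B" by auto
    with ab(3) show "\<gamma> \<in> (\<lambda>(\<alpha>, \<beta>). \<alpha> + \<beta>) ` (?A \<times> ?B)" by force
  qed
  moreover have "finite (?A \<times> ?B)"
    using f g by (simp add: mem_gen_puiseux_series_iff)
  ultimately show "finite {\<gamma>. \<gamma> \<le> x \<and> puiseux_mult f g \<gamma> \<noteq> 0}"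
    by (meson finite_imageI finite_subset)
qed

text \<open>
  Both bracketings are double sums of \<open>f \<alpha> * g (\<gamma> - \<alpha> - \<beta>) * h \<beta>\<close>. With lower bounds
  \<open>m1\<close>, \<open>m2\<close>, \<open>m3\<close> of the three supports, only finitely many \<open>\<alpha>\<close> and \<open>\<beta>\<close> contribute to the
  coefficient at \<open>\<gamma>\<close>, and the choice of these finite sets does not depend on the bracketing.
\<close>
lemma puiseux_mult_assoc:
  assumes f: "f \<in> gen_puiseux_series" and g: "g \<in> gen_puiseux_series" and h: "h \<in> gen_puiseux_series"
  shows "puiseux_mult (puiseux_mult f g) h = puiseux_mult f (puiseux_mult g h)"
proof
  fix \<gamma>
  obtain m1 where m1: "\<And>\<alpha>. f \<alpha> \<noteq> 0 \<Longrightarrow> m1 \<le> \<alpha>"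
    using gen_puiseux_series_lower_bound[OF f] by blast
  obtain m2 where m2: "\<And>\<alpha>. g \<alpha> \<noteq> 0 \<Longrightarrow> m2 \<le> \<alpha>"
    using gen_puiseux_series_lower_bound[OF g] by blast
  obtain m3 where m3: "\<And>\<alpha>. h \<alpha> \<noteq> 0 \<Longrightarrow> m3 \<le> \<alpha>"
    using gen_puiseux_series_lower_bound[OF h] by blast
  have low: "m + m' \<le> \<delta>"
    if "\<And>\<alpha>. u \<alpha> \<noteq> 0 \<Longrightarrow> m \<le> \<alpha>" "\<And>\<alpha>. v \<alpha> \<noteq> 0 \<Longrightarrow> m' \<le> \<alpha>" "puiseux_mult u v \<delta> \<noteq> 0"
    for u v m m' \<delta>
    using that(3) by (rule puiseux_mult_nonzeroE) (use that(1,2) add_mono in blast)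
  let ?A = "{\<alpha>. \<alpha> \<le> \<gamma> - (m2 + m3) \<and> f \<alpha> \<noteq> 0}"
  let ?C = "{\<beta>. \<beta> \<le> \<gamma> - (m1 + m2) \<and> h \<beta> \<noteq> 0}"
  have A: "finite ?A" and C: "finite ?C"
    using f h by (simp_all add: mem_gen_puiseux_series_iff)
  have "puiseux_mult (puiseux_mult f g) h \<gamma> = (\<Sum>\<beta>\<in>?C. h \<beta> * puiseux_mult f g (\<gamma> - \<beta>))"
    by (subst puiseux_mult_commute, rule puiseux_mult_eq_sum[OF C])
       (use low[of f m1 g m2, OF m1 m2] in force)
  also have "\<dots> = (\<Sum>\<beta>\<in>?C. \<Sum>\<alpha>\<in>?A. f \<alpha> * (g (\<gamma> - \<beta> - \<alpha>) * h \<beta>))"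
  proof (rule sum.cong[OF refl])
    fix \<beta> assume "\<beta> \<in> ?C"
    then have "puiseux_mult f g (\<gamma> - \<beta>) = (\<Sum>\<alpha>\<in>?A. f \<alpha> * g (\<gamma> - \<beta> - \<alpha>))"
      using m2 m3 by (intro puiseux_mult_eq_sum[OF A]) force
    then show "h \<beta> * puiseux_mult f g (\<gamma> - \<beta>) = (\<Sum>\<alpha>\<in>?A. f \<alpha> * (g (\<gamma> - \<beta> - \<alpha>) * h \<beta>))"
      by (simp add: sum_distrib_left mult_ac)
  qed
  also have "\<dots> = (\<Sum>\<alpha>\<in>?A. \<Sum>\<beta>\<in>?C. f \<alpha> * (g (\<gamma> - \<beta> - \<alpha>) * h \<beta>))"
    by (rule sum.swap)
  also have "\<dots> = (\<Sum>\<alpha>\<in>?A. f \<alpha> * puiseux_mult g h (\<gamma> - \<alpha>))"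
  proof (rule sum.cong[OF refl])
    fix \<alpha> assume "\<alpha> \<in> ?A"
    then have "puiseux_mult h g (\<gamma> - \<alpha>) = (\<Sum>\<beta>\<in>?C. h \<beta> * g (\<gamma> - \<alpha> - \<beta>))"
      using m1 m2 by (intro puiseux_mult_eq_sum[OF C]) force
    then show "(\<Sum>\<beta>\<in>?C. f \<alpha> * (g (\<gamma> - \<beta> - \<alpha>) * h \<beta>)) = f \<alpha> * puiseux_mult g h (\<gamma> - \<alpha>)"
      by (simp add: puiseux_mult_commute[of g] sum_distrib_left algebra_simps)
  qed
  also have "\<dots> = puiseux_mult f (puiseux_mult g h) \<gamma>"
    by (rule sym, rule puiseux_mult_eq_sum[OF A])
       (use low[of g m2 h m3, OF m2 m3] in force)
  finally show "puiseux_mult (puiseux_mult f g) h \<gamma> = puiseux_mult f (puiseux_mult g h) \<gamma>" .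
qed

lemma puiseux_mult_distrib_right:
  assumes f: "f \<in> gen_puiseux_series" and g: "g \<in> gen_puiseux_series" and h: "h \<in> gen_puiseux_series"
  shows "puiseux_mult (\<lambda>\<gamma>. f \<gamma> + g \<gamma>) h = (\<lambda>\<gamma>. puiseux_mult f h \<gamma> + puiseux_mult g h \<gamma>)"
proof
  fix \<gamma>
  obtain m where m: "\<And>\<alpha>. h \<alpha> \<noteq> 0 \<Longrightarrow> m \<le> \<alpha>"
    using gen_puiseux_series_lower_bound[OF h] by blast
  let ?A = "{\<alpha>. \<alpha> \<le> \<gamma> - m \<and> f \<alpha> \<noteq> 0} \<union> {\<alpha>. \<alpha> \<le> \<gamma> - m \<and> g \<alpha> \<noteq> 0}"
  have A: "finite ?A"
    using f g by (simp add: mem_gen_puiseux_series_iff)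
  have *: "\<alpha> \<in> ?A" if "f \<alpha> \<noteq> 0 \<or> g \<alpha> \<noteq> 0" "h (\<gamma> - \<alpha>) \<noteq> 0" for \<alpha>
    using that m[of "\<gamma> - \<alpha>"] by auto
  have "puiseux_mult (\<lambda>\<gamma>. f \<gamma> + g \<gamma>) h \<gamma> = (\<Sum>\<alpha>\<in>?A. (f \<alpha> + g \<alpha>) * h (\<gamma> - \<alpha>))"
    by (rule puiseux_mult_eq_sum[OF A], rule *) auto
  also have "\<dots> = (\<Sum>\<alpha>\<in>?A. f \<alpha> * h (\<gamma> - \<alpha>)) + (\<Sum>\<alpha>\<in>?A. g \<alpha> * h (\<gamma> - \<alpha>))"
    by (simp add: distrib_right sum.distrib)
  also have "(\<Sum>\<alpha>\<in>?A. f \<alpha> * h (\<gamma> - \<alpha>)) = puiseux_mult f h \<gamma>"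
    by (rule sym, rule puiseux_mult_eq_sum[OF A], rule *) auto
  also have "(\<Sum>\<alpha>\<in>?A. g \<alpha> * h (\<gamma> - \<alpha>)) = puiseux_mult g h \<gamma>"
    by (rule sym, rule puiseux_mult_eq_sum[OF A], rule *) auto
  finally show "puiseux_mult (\<lambda>\<gamma>. f \<gamma> + g \<gamma>) h \<gamma> = puiseux_mult f h \<gamma> + puiseux_mult g h \<gamma>" .
qed

text \<open>
  Monomials act by shifting exponents; this yields the unit law and, later, the substitution
  that normalizes the slopes of a polynomial.
\<close>
lemma puiseux_mult_monomial:
  "puiseux_mult (\<lambda>\<gamma>. if \<gamma> = a then c else 0) g = (\<lambda>\<gamma>. c * g (\<gamma> - a))"
proof
  fix \<gamma>
  have "puiseux_mult (\<lambda>\<gamma>. if \<gamma> = a then c else 0) g \<gamma>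
      = (\<Sum>\<alpha>\<in>{a}. (if \<alpha> = a then c else 0) * g (\<gamma> - \<alpha>))"
    by (rule puiseux_mult_eq_sum) (auto split: if_splits)
  then show "puiseux_mult (\<lambda>\<gamma>. if \<gamma> = a then c else 0) g \<gamma> = c * g (\<gamma> - a)"
    by simp
qed

section \<open>The ring of generalised Puiseux series\<close>

text \<open>
  As a type with the class \<open>field\<close>, the series get the theory of univariate polynomials, in
  particular division with remainder and the criteria for algebraically closed fields.
\<close>
typedef gpuiseux = gen_puiseux_series
  morphisms gp_coeff Abs_gpuiseux
proof
  show "(\<lambda>_. 0) \<in> gen_puiseux_series"
    by (simp add: mem_gen_puiseux_series_iff)
qed

setup_lifting type_definition_gpuiseux

lemma finite_gp_support: "finite {\<alpha>. \<alpha> \<le> x \<and> gp_coeff f \<alpha> \<noteq> 0}"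
  using gp_coeff[of f] by (simp add: mem_gen_puiseux_series_iff)

lift_definition gp_monom :: "real \<Rightarrow> complex \<Rightarrow> gpuiseux"
  is "\<lambda>a c \<gamma>. if \<gamma> = a then c else 0"
  unfolding mem_gen_puiseux_series_iff
  by (rule allI, rule finite_subset[of _ "{a}" for a]) auto

instantiation gpuiseux :: comm_ring_1
begin

lift_definition zero_gpuiseux :: gpuiseux is "\<lambda>_. 0"
  by (simp add: mem_gen_puiseux_series_iff)

lift_definition one_gpuiseux :: gpuiseux is "\<lambda>\<gamma>. if \<gamma> = 0 then 1 else 0"
  unfolding mem_gen_puiseux_series_iff
  by (rule allI, rule finite_subset[of _ "{0}"]) auto

lift_definition plus_gpuiseux :: "gpuiseux \<Rightarrow> gpuiseux \<Rightarrow> gpuiseux" is "\<lambda>f g \<gamma>. f \<gamma> + g \<gamma>"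
  subgoal premises prems for f g
    unfolding mem_gen_puiseux_series_iff
  proof
    fix x
    have "finite ({\<alpha>. \<alpha> \<le> x \<and> f \<alpha> \<noteq> 0} \<union> {\<alpha>. \<alpha> \<le> x \<and> g \<alpha> \<noteq> 0})"
      using prems by (simp add: mem_gen_puiseux_series_iff)
    then show "finite {\<alpha>. \<alpha> \<le> x \<and> f \<alpha> + g \<alpha> \<noteq> 0}"
      by (rule rev_finite_subset) auto
  qed
  done

lift_definition uminus_gpuiseux :: "gpuiseux \<Rightarrow> gpuiseux" is "\<lambda>f \<gamma>. - f \<gamma>"
  by (simp add: mem_gen_puiseux_series_iff)

definition minus_gpuiseux :: "gpuiseux \<Rightarrow> gpuiseux \<Rightarrow> gpuiseux"
  where "minus_gpuiseux f g = f + - g"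

lift_definition times_gpuiseux :: "gpuiseux \<Rightarrow> gpuiseux \<Rightarrow> gpuiseux" is puiseux_mult
  by (rule puiseux_mult_closed)

instance
proof
  fix a b c :: gpuiseux
  show "a * b * c = a * (b * c)"
    by transfer (rule puiseux_mult_assoc)
  show "a * b = b * a"
    by transfer (rule puiseux_mult_commute)
  show "1 * a = a"
    by transfer (simp add: puiseux_mult_monomial)
  show "a + b + c = a + (b + c)"
    by transfer (simp add: add_ac)
  show "a + b = b + a"
    by transfer (simp add: add_ac)
  show "0 + a = a"
    by transfer simp
  show "- a + a = 0"
    by transfer simp
  show "a - b = a + - b"
    by (simp add: minus_gpuiseux_def)
  show "(a + b) * c = a * c + b * c"
    by transfer (rule puiseux_mult_distrib_right)
  show "(0 :: gpuiseux) \<noteq> 1"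
    by transfer (auto simp: fun_eq_iff)
qed

end

lemma gp_coeff_simps [simp]:
  "gp_coeff 0 \<gamma> = 0"
  "gp_coeff 1 \<gamma> = (if \<gamma> = 0 then 1 else 0)"
  "gp_coeff (f + g) \<gamma> = gp_coeff f \<gamma> + gp_coeff g \<gamma>"
  "gp_coeff (- f) \<gamma> = - gp_coeff f \<gamma>"
  "gp_coeff (f - g) \<gamma> = gp_coeff f \<gamma> - gp_coeff g \<gamma>"
  "gp_coeff (gp_monom a c) \<gamma> = (if \<gamma> = a then c else 0)"
  "gp_coeff (gp_monom a c * f) \<gamma> = c * gp_coeff f (\<gamma> - a)"
proof -
  show "gp_coeff (f - g) \<gamma> = gp_coeff f \<gamma> - gp_coeff g \<gamma>"
    unfolding minus_gpuiseux_def by transfer simp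
  show "gp_coeff (gp_monom a c * f) \<gamma> = c * gp_coeff f (\<gamma> - a)"
    by transfer (simp add: puiseux_mult_monomial)
qed (transfer, simp)+

lemma gp_eqI: "(\<And>\<gamma>. gp_coeff f \<gamma> = gp_coeff g \<gamma>) \<Longrightarrow> f = g"
  by (metis gp_coeff_inject ext)

lemma gp_monom_mult: "gp_monom a c * gp_monom b d = gp_monom (a + b) (c * d)"
  by (rule gp_eqI) auto

lemma gp_monom_add: "gp_monom a (c + d) = gp_monom a c + gp_monom a d"
  by (rule gp_eqI) auto

lemma gp_monom_0 [simp]: "gp_monom a 0 = 0"
  by (rule gp_eqI) auto

lemma gp_monom_sum: "gp_monom a (sum f A) = (\<Sum>i\<in>A. gp_monom a (f i))"
  by (induction A rule: infinite_finite_induct) (auto simp: gp_monom_add)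

lemma gp_monom_eq_0_iff [simp]: "gp_monom a c = 0 \<longleftrightarrow> c = 0"
proof
  assume "gp_monom a c = 0"
  then have "gp_coeff (gp_monom a c) a = 0" by simp
  then show "c = 0" by simp
qed simp


lemma gp_monom_1: "gp_monom 0 1 = 1"
  by (rule gp_eqI) auto

lemma gp_monom_power: "gp_monom a 1 ^ k = gp_monom (real k * a) 1"
  by (induction k) (simp_all add: gp_monom_1 gp_monom_mult algebra_simps)

section \<open>Completeness for the order filtration\<close>

text \<open>
  Meaning that \<open>f\<close> has order at least \<open>c\<close>. Only such inequalities are needed, and stated through
  the coefficients they include the zero series, whose order is infinite.
\<close>
definition vanishes_below :: "real \<Rightarrow> gpuiseux \<Rightarrow> bool"
  where "vanishes_below c f \<longleftrightarrow> (\<forall>\<gamma><c. gp_coeff f \<gamma> = 0)"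

lemma vanishes_belowD: "vanishes_below c f \<Longrightarrow> \<gamma> < c \<Longrightarrow> gp_coeff f \<gamma> = 0"
  by (simp add: vanishes_below_def)

lemma vanishes_below_mono: "vanishes_below d f \<Longrightarrow> c \<le> d \<Longrightarrow> vanishes_below c f"
  by (simp add: vanishes_below_def)

lemma vanishes_below_0 [simp]: "vanishes_below c 0"
  by (simp add: vanishes_below_def)

lemma vanishes_below_add: "vanishes_below c f \<Longrightarrow> vanishes_below c g \<Longrightarrow> vanishes_below c (f + g)"
  by (simp add: vanishes_below_def)

lemma vanishes_below_minus: "vanishes_below c f \<Longrightarrow> vanishes_below c (- f)"
  by (simp add: vanishes_below_def)

lemma vanishes_below_diff: "vanishes_below c f \<Longrightarrow> vanishes_below c g \<Longrightarrow> vanishes_below c (f - g)"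
  by (simp add: vanishes_below_def)

lemma vanishes_below_sum: "(\<And>i. i \<in> A \<Longrightarrow> vanishes_below c (f i)) \<Longrightarrow> vanishes_below c (sum f A)"
  by (induction A rule: infinite_finite_induct) (auto intro: vanishes_below_add)

lemma vanishes_below_mult:
  assumes "vanishes_below c f" "vanishes_below d g"
  shows "vanishes_below (c + d) (f * g)"
  unfolding vanishes_below_def
proof (intro allI impI)
  fix \<gamma> assume "\<gamma> < c + d"
  have "gp_coeff f \<alpha> = 0 \<or> gp_coeff g (\<gamma> - \<alpha>) = 0" for \<alpha>
    using assms \<open>\<gamma> < c + d\<close> unfolding vanishes_below_def
    by (cases "\<alpha> < c") auto
  then show "gp_coeff (f * g) \<gamma> = 0"
    unfolding times_gpuiseux.rep_eq by (subst puiseux_mult_eq_sum[of "{}"]) auto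
qed

lemma vanishes_below_monom: "c \<le> a \<Longrightarrow> vanishes_below c (gp_monom a b)"
  by (simp add: vanishes_below_def)

lemma vanishes_below_1: "c \<le> 0 \<Longrightarrow> vanishes_below c 1"
  by (simp add: vanishes_below_def)

lemma vanishes_below_all_imp_0:
  assumes "\<epsilon> > 0" "\<And>k. vanishes_below (real k * \<epsilon>) f"
  shows "f = 0"
proof (rule gp_eqI)
  fix \<gamma>
  obtain k where "\<gamma> < real k * \<epsilon>"
    using reals_Archimedean3[OF assms(1)] by blast
  with assms(2) show "gp_coeff f \<gamma> = gp_coeff 0 \<gamma>"
    using vanishes_belowD[OF assms(2)] by simp
qed

text \<open>
  Local finiteness leaves a gap: a series with only positive exponents has order bounded away
  from \<open>0\<close>. All contractions below get their factor from this gap.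
\<close>
lemma vanishes_below_pos:
  assumes "\<And>\<gamma>. \<gamma> \<le> 0 \<Longrightarrow> gp_coeff f \<gamma> = 0"
  obtains \<epsilon> where "\<epsilon> > 0" "vanishes_below \<epsilon> f"
proof -
  let ?A = "insert 1 {\<alpha>. \<alpha> \<le> 1 \<and> gp_coeff f \<alpha> \<noteq> 0}"
  have fin: "finite ?A"
    using finite_gp_support by simp
  show ?thesis
  proof
    show "Min ?A > 0"
    proof (subst Min_gr_iff[OF fin])
      show "\<forall>\<alpha>\<in>?A. \<alpha> > 0"
      proof
        fix \<alpha> assume "\<alpha> \<in> ?A"
        then show "\<alpha> > 0"
          using assms[of \<alpha>] by (cases "\<alpha> \<le> 0") auto
      qed
    qed simp
    show "vanishes_below (Min ?A) f"
      unfolding vanishes_below_def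
    proof (intro allI impI)
      fix \<gamma> assume "\<gamma> < Min ?A"
      then have "\<gamma> < \<alpha>" if "\<alpha> \<in> ?A" for \<alpha>
        using Min_le[OF fin that] by simp
      from this[of 1] this[of \<gamma>] show "gp_coeff f \<gamma> = 0" by auto
    qed
  qed
qed

text \<open>
  If the order of the \<open>k\<close>-th increment is at least \<open>k * \<epsilon>\<close>, then each coefficient of \<open>x k\<close> is
  eventually constant, and below any bound the limit agrees with one fixed \<open>x k\<close>, so its support
  is again locally finite.
\<close>
lemma gpuiseux_complete:
  fixes x :: "nat \<Rightarrow> gpuiseux"
  assumes eps: "\<epsilon> > 0" and cauchy: "\<And>k. vanishes_below (real k * \<epsilon>) (x (Suc k) - x k)"
  obtains y where "\<And>k. vanishes_below (real k * \<epsilon>) (y - x k)"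
proof -
  have diff: "vanishes_below (real k * \<epsilon>) (x m - x k)" if "k \<le> m" for k m
    using that
  proof (induction m rule: dec_induct)
    case (step m)
    have "vanishes_below (real k * \<epsilon>) (x (Suc m) - x m)"
      by (rule vanishes_below_mono[OF cauchy]) (use step eps in auto)
    with step.IH show ?case
      using vanishes_below_add by fastforce
  qed simp
  have stable: "gp_coeff (x m) \<gamma> = gp_coeff (x k) \<gamma>" if "\<gamma> < real k * \<epsilon>" "\<gamma> < real m * \<epsilon>" for \<gamma> k m
    using that diff[of k m] diff[of m k] by (metis gp_coeff_simps(5) linorder_le_cases right_minus_eq vanishes_belowD)
  \<comment> \<open>an index from which on the coefficient at \<open>\<gamma>\<close> no longer changes\<close>
  define K where "K \<gamma> = (SOME k. \<gamma> < real k * \<epsilon>)" for \<gamma>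
  have K: "\<gamma> < real (K \<gamma>) * \<epsilon>" for \<gamma>
    unfolding K_def by (rule someI_ex) (use reals_Archimedean3[OF eps] in blast)
  define f where "f \<gamma> = gp_coeff (x (K \<gamma>)) \<gamma>" for \<gamma>
  have f: "f \<gamma> = gp_coeff (x k) \<gamma>" if "\<gamma> < real k * \<epsilon>" for \<gamma> k
    unfolding f_def by (rule stable[OF that K])
  have "f \<in> gen_puiseux_series"
    unfolding mem_gen_puiseux_series_iff
  proof
    fix z
    have "{\<alpha>. \<alpha> \<le> z \<and> f \<alpha> \<noteq> 0} \<subseteq> {\<alpha>. \<alpha> \<le> z \<and> gp_coeff (x (K z)) \<alpha> \<noteq> 0}"
      using f[of _ "K z"] K[of z] by auto
    then show "finite {\<alpha>. \<alpha> \<le> z \<and> f \<alpha> \<noteq> 0}"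
      using finite_gp_support finite_subset by blast
  qed
  then have "gp_coeff (Abs_gpuiseux f) = f"
    by (rule Abs_gpuiseux_inverse)
  with f have "vanishes_below (real k * \<epsilon>) (Abs_gpuiseux f - x k)" for k
    by (simp add: vanishes_below_def)
  then show ?thesis by (rule that)
qed

section \<open>Inverses\<close>

lemma gp_order_exists:
  fixes f :: gpuiseux
  assumes "f \<noteq> 0"
  obtains v where "gp_coeff f v \<noteq> 0" "vanishes_below v f"
proof -
  obtain a where a: "gp_coeff f a \<noteq> 0"
    using assms gp_eqI[of f 0] by auto
  let ?A = "{\<alpha>. \<alpha> \<le> a \<and> gp_coeff f \<alpha> \<noteq> 0}"
  have fin: "finite ?A" by (rule finite_gp_support)
  have mem: "Min ?A \<in> ?A" by (rule Min_in[OF fin]) (use a in auto)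
  show ?thesis
  proof
    show "gp_coeff f (Min ?A) \<noteq> 0"
      using mem by blast
    show "vanishes_below (Min ?A) f"
      unfolding vanishes_below_def
    proof (intro allI impI, rule ccontr)
      fix \<gamma> assume "\<gamma> < Min ?A" "gp_coeff f \<gamma> \<noteq> 0"
      with mem have "\<gamma> \<in> ?A" by auto
      with fin have "Min ?A \<le> \<gamma>" by (rule Min_le)
      with \<open>\<gamma> < Min ?A\<close> show False by simp
    qed
  qed
qed

text \<open>
  After multiplication by the inverse of the leading monomial, \<open>f\<close> becomes \<open>1 - u\<close> with \<open>u\<close> of
  positive order. The inverse of \<open>1 - u\<close> is the fixed point of the contraction
  \<open>z \<mapsto> 1 + u * z\<close>, that is, the geometric series in \<open>u\<close>.
\<close>
lemma gp_inverse_exists: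
  fixes f :: gpuiseux
  assumes "f \<noteq> 0"
  shows "\<exists>g. g * f = 1"
proof -
  obtain v where v: "gp_coeff f v \<noteq> 0" "vanishes_below v f"
    using gp_order_exists[OF assms] .
  define m where "m = gp_monom (- v) (1 / gp_coeff f v)"
  define u where "u = 1 - m * f"
  have "gp_coeff u \<gamma> = 0" if "\<gamma> \<le> 0" for \<gamma>
    using that v vanishes_belowD[OF v(2), of "\<gamma> + v"] by (cases "\<gamma> = 0") (auto simp: u_def m_def)
  then obtain \<epsilon> where eps: "\<epsilon> > 0" "vanishes_below \<epsilon> u"
    using vanishes_below_pos by blast
  define x where "x k = ((\<lambda>z. 1 + u * z) ^^ k) 0" for k
  have x_Suc: "x (Suc k) = 1 + u * x k" for k
    by (simp add: x_def)
  have "vanishes_below (real k * \<epsilon>) (x (Suc k) - x k)" for k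
  proof (induction k)
    case 0
    show ?case by (simp add: x_def vanishes_below_1)
  next
    case (Suc k)
    have "x (Suc (Suc k)) - x (Suc k) = u * (x (Suc k) - x k)"
      by (simp only: x_Suc) (simp add: algebra_simps)
    then show ?case
      using vanishes_below_mult[OF eps(2) Suc.IH] by (simp add: distrib_right)
  qed
  from gpuiseux_complete[OF eps(1) this]
  obtain y where y: "\<And>k. vanishes_below (real k * \<epsilon>) (y - x k)" by blast
  have "y - (1 + u * y) = 0"
  proof (rule vanishes_below_all_imp_0[OF eps(1)])
    fix k
    have "vanishes_below (real k * \<epsilon>) (u * (y - x k))"
      by (rule vanishes_below_mono[OF vanishes_below_mult[OF eps(2) y[of k]]]) (use eps in simp)
    moreover have "vanishes_below (real k * \<epsilon>) (y - x (Suc k))"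
      by (rule vanishes_below_mono[OF y]) (use eps in \<open>simp add: algebra_simps\<close>)
    moreover have "y - (1 + u * y) = (y - x (Suc k)) - u * (y - x k)"
      by (simp add: x_Suc algebra_simps)
    ultimately show "vanishes_below (real k * \<epsilon>) (y - (1 + u * y))"
      by (simp only: vanishes_below_diff)
  qed
  then have "(y * m) * f = 1"
    by (simp add: u_def algebra_simps)
  then show ?thesis by blast
qed

instantiation gpuiseux :: field
begin

definition inverse_gpuiseux :: "gpuiseux \<Rightarrow> gpuiseux"
  where "inverse_gpuiseux f = (if f = 0 then 0 else SOME g. g * f = 1)"

definition divide_gpuiseux :: "gpuiseux \<Rightarrow> gpuiseux \<Rightarrow> gpuiseux"
  where "divide_gpuiseux f g = f * inverse g"

instance
proof
  fix f g :: gpuiseux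
  show "f \<noteq> 0 \<Longrightarrow> inverse f * f = 1"
    by (simp add: inverse_gpuiseux_def) (rule someI_ex, rule gp_inverse_exists)
  show "f div g = f * inverse g"
    by (simp add: divide_gpuiseux_def)
  show "inverse (0 :: gpuiseux) = 0"
    by (simp add: inverse_gpuiseux_def)
qed

end

instance gpuiseux :: field_char_0
proof
  have "gp_coeff (of_nat n) 0 = of_nat n" for n
    by (induction n) auto
  then show "inj (of_nat :: nat \<Rightarrow> gpuiseux)"
    by (intro injI) (metis of_nat_eq_iff)
qed

section \<open>Lifting coprime factorizations\<close>

text \<open>
  The Gauss extension of the filtration to polynomials; like the Gauss norm it is compatible with
  products.
\<close>
definition poly_vanishes_below :: "real \<Rightarrow> gpuiseux poly \<Rightarrow> bool"
  where "poly_vanishes_below c p \<longleftrightarrow> (\<forall>i. vanishes_below c (coeff p i))"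

lemma poly_vanishes_below_mono:
  "poly_vanishes_below d p \<Longrightarrow> c \<le> d \<Longrightarrow> poly_vanishes_below c p"
  using vanishes_below_mono by (auto simp: poly_vanishes_below_def)

lemma poly_vanishes_below_add:
  "poly_vanishes_below c p \<Longrightarrow> poly_vanishes_below c q \<Longrightarrow> poly_vanishes_below c (p + q)"
  by (simp add: poly_vanishes_below_def vanishes_below_add)

lemma poly_vanishes_below_minus: "poly_vanishes_below c p \<Longrightarrow> poly_vanishes_below c (- p)"
  by (simp add: poly_vanishes_below_def vanishes_below_minus)

lemma poly_vanishes_below_diff:
  "poly_vanishes_below c p \<Longrightarrow> poly_vanishes_below c q \<Longrightarrow> poly_vanishes_below c (p - q)"
  by (simp add: poly_vanishes_below_def vanishes_below_diff)

lemma poly_vanishes_below_mult: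
  "poly_vanishes_below c p \<Longrightarrow> poly_vanishes_below d q \<Longrightarrow> poly_vanishes_below (c + d) (p * q)"
  by (simp add: poly_vanishes_below_def coeff_mult vanishes_below_sum vanishes_below_mult)

lemma poly_vanishes_below_all_imp_0:
  assumes "\<epsilon> > 0" "\<And>k. poly_vanishes_below (real k * \<epsilon>) p"
  shows "p = 0"
  using assms(2) vanishes_below_all_imp_0[OF assms(1)]
  by (auto simp: poly_vanishes_below_def poly_eq_iff)

text \<open>
  The bound on the degrees is what makes the coefficientwise limit a polynomial.
\<close>
lemma gpuiseux_poly_complete:
  fixes x :: "nat \<Rightarrow> gpuiseux poly"
  assumes eps: "\<epsilon> > 0"
    and cauchy: "\<And>k. poly_vanishes_below (real k * \<epsilon>) (x (Suc k) - x k)"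
    and deg: "\<And>k. degree (x k) < n"
  obtains y where "degree y < n" "\<And>k. poly_vanishes_below (real k * \<epsilon>) (y - x k)"
proof -
  have "\<exists>z. \<forall>k. vanishes_below (real k * \<epsilon>) (z - coeff (x k) i)" for i
    by (rule gpuiseux_complete[OF eps, of "\<lambda>k. coeff (x k) i"])
       (use cauchy in \<open>auto simp: poly_vanishes_below_def\<close>)
  then obtain z where z: "\<And>i k. vanishes_below (real k * \<epsilon>) (z i - coeff (x k) i)"
    by metis
  define y where "y = (\<Sum>i<n. monom (z i) i)"
  have y: "coeff y i = (if i < n then z i else 0)" for i
    by (simp add: y_def coeff_sum)
  show ?thesis
  proof
    show "degree y < n"
      using y deg[of 0] by (intro degree_lessI) auto
    show "poly_vanishes_below (real k * \<epsilon>) (y - x k)" for k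
      unfolding poly_vanishes_below_def
    proof
      fix i show "vanishes_below (real k * \<epsilon>) (coeff (y - x k) i)"
        using z[of k i] deg[of k] by (simp add: y coeff_eq_0)
    qed
  qed
qed

definition const_poly :: "complex poly \<Rightarrow> gpuiseux poly"
  where "const_poly = map_poly (gp_monom 0)"

lemma coeff_const_poly [simp]: "coeff (const_poly p) i = gp_monom 0 (coeff p i)"
  by (simp add: const_poly_def coeff_map_poly)

lemma const_poly_add: "const_poly (p + q) = const_poly p + const_poly q"
  by (rule poly_eqI) (simp add: gp_monom_add)

lemma const_poly_mult: "const_poly (p * q) = const_poly p * const_poly q"
  by (rule poly_eqI) (simp add: coeff_mult gp_monom_sum gp_monom_mult)

lemma const_poly_1: "const_poly 1 = 1"
  by (rule poly_eqI) (simp add: gp_monom_1)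

lemma degree_const_poly [simp]: "degree (const_poly p) = degree p"
  unfolding const_poly_def by (rule degree_map_poly) simp

lemma const_poly_eq_0_iff [simp]: "const_poly p = 0 \<longleftrightarrow> p = 0"
  by (simp add: poly_eq_iff)

lemma poly_vanishes_below_const_poly: "c \<le> 0 \<Longrightarrow> poly_vanishes_below c (const_poly p)"
  by (simp add: poly_vanishes_below_def vanishes_below_monom)

text \<open>
  Division by a polynomial with complex coefficients does not lower the order: every step of the
  division subtracts a multiple of the divisor by a coefficient of the dividend, divided by a
  nonzero complex number, and such numbers have order \<open>0\<close>.
\<close>
lemma poly_vanishes_below_mod_const_poly:
  assumes "poly_vanishes_below c p" "g \<noteq> 0"
  shows "poly_vanishes_below c (p mod const_poly g)"
  using assms(1)
proof (induction p)
  case 0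
  then show ?case by simp
next
  case (pCons a p)
  have "vanishes_below c a" and p: "poly_vanishes_below c p"
    using pCons.prems unfolding poly_vanishes_below_def by (force simp: coeff_pCons split: nat.splits dest: spec[of _ 0] spec[of _ "Suc _"])+
  define r where "r = pCons a (p mod const_poly g)"
  have r: "poly_vanishes_below c r"
    using \<open>vanishes_below c a\<close> pCons.IH[OF p]
    by (auto simp: r_def poly_vanishes_below_def coeff_pCons split: nat.splits)
  define l where "l = coeff g (degree g)"
  have "l \<noteq> 0" using assms(2) by (simp add: l_def)
  then have "gp_monom 0 l * gp_monom 0 (1 / l) = 1"
    by (simp add: gp_monom_mult gp_monom_1)
  then have div: "b / gp_monom 0 l = b * gp_monom 0 (1 / l)" for b
    using \<open>l \<noteq> 0\<close> by (simp add: field_simps)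
  have "pCons a p mod const_poly g
      = r - smult (coeff r (degree g) * gp_monom 0 (1 / l)) (const_poly g)"
    using assms(2) mod_pCons[of "const_poly g" a p]
    by (simp add: r_def l_def[symmetric] div)
  moreover have "poly_vanishes_below c (smult (coeff r (degree g) * gp_monom 0 (1 / l)) (const_poly g))"
  proof -
    have "vanishes_below (c + 0 + 0) (coeff r (degree g) * gp_monom 0 (1 / l) * gp_monom 0 b)" for b
      using r by (intro vanishes_below_mult vanishes_below_monom) (simp_all add: poly_vanishes_below_def)
    then show ?thesis by (simp add: poly_vanishes_below_def)
  qed
  ultimately show ?case
    using r poly_vanishes_below_diff by simp
qed

text \<open>
  A version of Hensel's lemma. Let \<open>g\<close>, \<open>h\<close> be the given factors, regarded over the series, and
  \<open>e = q - g * h\<close>. Sought are corrections \<open>u\<close>, \<open>w\<close> of degrees below those of \<open>g\<close>, \<open>h\<close> with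
  \<open>(g + u) * (h + w) = q\<close>, that is, \<open>u * h + w * g = e - u * w\<close>. By coprimality the linear
  problem \<open>u * h + w * g = E\<close> has a solution \<open>u = U E\<close>, \<open>w = W E\<close> that depends linearly on \<open>E\<close>;
  since the Bezout coefficients are complex polynomials, \<open>U\<close> and \<open>W\<close> do not lower the order. It
  remains to solve \<open>E = e - U E * W E\<close>, and the right-hand side is a contraction on polynomials
  of order at least \<open>\<epsilon>\<close>, because it is quadratic in \<open>E\<close>.
\<close>
lemma coprime_factorization_lifts:
  fixes q :: "gpuiseux poly" and r s :: "complex poly"
  assumes coprime: "coprime r s" and deg_r: "degree r > 0" and deg_s: "degree s > 0"
    and eps: "\<epsilon> > 0" and close: "poly_vanishes_below \<epsilon> (q - const_poly (r * s))"
    and deg: "degree (q - const_poly (r * s)) < degree r + degree s"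
  obtains g h where "q = g * h" "degree g = degree r" "degree h = degree s"
proof -
  from coprime obtain a b where ab: "a * s + b * r = 1"
    using bezout_coefficients_fst_snd[of s r] by (metis coprime_commute coprime_iff_gcd_eq_1)
  define n where "n = degree r + degree s"
  define g h where "g = const_poly r" and "h = const_poly s"
  define \<alpha> \<beta> where "\<alpha> = const_poly a" and "\<beta> = const_poly b"
  have bezout: "\<alpha> * h + \<beta> * g = 1"
    using arg_cong[OF ab, of const_poly]
    by (simp add: \<alpha>_def \<beta>_def g_def h_def const_poly_add const_poly_mult const_poly_1)
  have gh: "g \<noteq> 0" "h \<noteq> 0" "degree g = degree r" "degree h = degree s"
    using deg_r deg_s by (auto simp: g_def h_def)
  define e where "e = q - g * h"
  have e: "poly_vanishes_below \<epsilon> e" "degree e < n"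
    using close deg by (simp_all add: e_def g_def h_def const_poly_mult n_def)
  define U W where "U E = (\<alpha> * E) mod g" and "W E = (\<beta> * E) mod h" for E
  have deg_U: "degree (U E) < degree r" for E
    using degree_mod_less[of g "\<alpha> * E"] gh deg_r by (auto simp: U_def)
  have deg_W: "degree (W E) < degree s" for E
    using degree_mod_less[of h "\<beta> * E"] gh deg_s by (auto simp: W_def)
  have U_diff: "U (E - E') = U E - U E'" and W_diff: "W (E - E') = W E - W E'" for E E'
    by (simp_all add: U_def W_def right_diff_distrib poly_mod_diff_left)
  have U_small: "poly_vanishes_below c (U E)" and W_small: "poly_vanishes_below c (W E)"
    if "poly_vanishes_below c E" for c E
  proof -
    have "poly_vanishes_below (0 + c) (\<alpha> * E)" "poly_vanishes_below (0 + c) (\<beta> * E)"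
      unfolding \<alpha>_def \<beta>_def by (intro poly_vanishes_below_mult poly_vanishes_below_const_poly that order.refl)+
    then show "poly_vanishes_below c (U E)" "poly_vanishes_below c (W E)"
      using deg_r deg_s
      by (auto simp: U_def W_def g_def h_def intro!: poly_vanishes_below_mod_const_poly)
  qed
  \<comment> \<open>Bezout gives this identity up to a multiple of \<open>g * h\<close>, which vanishes for reasons of degree.\<close>
  have solve: "U E * h + W E * g = E" if "degree E < n" for E
  proof -
    have "U E * h + W E * g
        = (\<alpha> * E - \<alpha> * E div g * g) * h + (\<beta> * E - \<beta> * E div h * h) * g"
      by (simp add: U_def W_def minus_div_mult_eq_mod)
    also have "\<dots> = (\<alpha> * h + \<beta> * g) * E - g * h * (\<alpha> * E div g + \<beta> * E div h)"
      by (simp add: algebra_simps)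
    finally have eq: "U E * h + W E * g = E - g * h * (\<alpha> * E div g + \<beta> * E div h)"
      by (simp add: bezout)
    have "degree (U E * h) < n" "degree (W E * g) < n"
      using degree_mult_le[of "U E" h] degree_mult_le[of "W E" g] deg_U[of E] deg_W[of E] gh
      by (auto simp: n_def)
    then have "degree (E - (U E * h + W E * g)) < n"
      using that by (intro degree_diff_less degree_add_less)
    then have "degree (g * h * (\<alpha> * E div g + \<beta> * E div h)) < degree (g * h)"
      using gh by (simp add: eq n_def degree_mult_eq)
    then have "\<alpha> * E div g + \<beta> * E div h = 0"
      using gh by (metis degree_mult_right_le not_le)
    with eq show ?thesis by simp
  qed
  define \<Phi> where "\<Phi> E = e - U E * W E" for E
  have deg_\<Phi>: "degree (\<Phi> E) < n" for E
    unfolding \<Phi>_def using degree_mult_le[of "U E" "W E"] deg_U[of E] deg_W[of E] e(2)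
    by (intro degree_diff_less) (auto simp: n_def)
  have \<Phi>_small: "poly_vanishes_below \<epsilon> (\<Phi> E)" if "poly_vanishes_below \<epsilon> E" for E
  proof -
    have "poly_vanishes_below (\<epsilon> + \<epsilon>) (U E * W E)"
      by (intro poly_vanishes_below_mult U_small W_small that)
    then have "poly_vanishes_below \<epsilon> (U E * W E)"
      by (rule poly_vanishes_below_mono) (use eps in simp)
    with e(1) show ?thesis
      unfolding \<Phi>_def by (rule poly_vanishes_below_diff)
  qed
  have contract: "poly_vanishes_below (c + \<epsilon>) (\<Phi> E - \<Phi> E')"
    if "poly_vanishes_below c (E - E')" "poly_vanishes_below \<epsilon> E" "poly_vanishes_below \<epsilon> E'" for c E E'
  proof -
    have "\<Phi> E - \<Phi> E' = - (U (E - E') * W E + W (E - E') * U E')"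
      by (simp add: \<Phi>_def U_diff W_diff algebra_simps)
    moreover have "poly_vanishes_below (c + \<epsilon>) (U (E - E') * W E + W (E - E') * U E')"
      by (intro poly_vanishes_below_add poly_vanishes_below_mult U_small W_small that)
    ultimately show ?thesis
      by (simp only: poly_vanishes_below_minus)
  qed
  define x where "x k = (\<Phi> ^^ k) 0" for k
  have x_Suc: "x (Suc k) = \<Phi> (x k)" for k
    by (simp add: x_def)
  have small: "poly_vanishes_below \<epsilon> (x k)" for k
    by (induction k) (simp_all add: x_Suc \<Phi>_small, simp add: x_def poly_vanishes_below_def)
  have deg_x: "degree (x k) < n" for k
    using deg_\<Phi> e(2) by (cases k) (auto simp: x_Suc, simp add: x_def)
  have cauchy: "poly_vanishes_below (real k * \<epsilon>) (x (Suc k) - x k)" for k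
  proof (induction k)
    case 0
    show ?case
      using small[of 1] eps by (auto simp: x_def intro: poly_vanishes_below_mono)
  next
    case (Suc k)
    show ?case
      using contract[OF Suc.IH small small] by (simp add: x_Suc distrib_right add.commute)
  qed
  obtain E where degE: "degree E < n" and E: "\<And>k. poly_vanishes_below (real k * \<epsilon>) (E - x k)"
    using gpuiseux_poly_complete[OF eps cauchy deg_x] by blast
  have E_small: "poly_vanishes_below \<epsilon> E"
    using poly_vanishes_below_add[OF _ small[of 1], of "E - x 1"] E[of 1] by simp
  have "\<Phi> E - E = 0"
  proof (rule poly_vanishes_below_all_imp_0[OF eps])
    fix k
    have "poly_vanishes_below (real k * \<epsilon>) (\<Phi> E - \<Phi> (x k))"
      by (rule poly_vanishes_below_mono[OF contract[OF E E_small small]]) (use eps in simp)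
    moreover have "poly_vanishes_below (real k * \<epsilon>) (E - x (Suc k))"
      by (rule poly_vanishes_below_mono[OF E]) (use eps in \<open>simp add: distrib_right\<close>)
    moreover have "\<Phi> E - E = (\<Phi> E - \<Phi> (x k)) - (E - x (Suc k))"
      by (simp add: x_Suc)
    ultimately show "poly_vanishes_below (real k * \<epsilon>) (\<Phi> E - E)"
      by (simp only: poly_vanishes_below_diff)
  qed
  then have fixpoint: "E + U E * W E = e"
    by (simp add: \<Phi>_def algebra_simps)
  show ?thesis
  proof
    have "(g + U E) * (h + W E) = g * h + (U E * h + W E * g) + U E * W E"
      by (simp add: algebra_simps)
    also have "\<dots> = g * h + e"
      by (simp only: solve[OF degE] add.assoc fixpoint)
    finally show "q = (g + U E) * (h + W E)"
      by (simp add: e_def)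
    show "degree (g + U E) = degree r" "degree (h + W E) = degree s"
      using deg_U[of E] deg_W[of E] gh by (simp_all add: degree_add_eq_left)
  qed
qed

section \<open>The Newton polygon and algebraic closedness\<close>

text \<open>
  A monic complex polynomial with a single root is \<open>(X - x)^n\<close>. Its second coefficient is
  \<open>- n * x\<close>, so if this vanishes, the polynomial is \<open>X^n\<close> and has no other nonzero coefficient.
\<close>
lemma depressed_poly_has_two_roots:
  fixes p :: "complex poly"
  assumes monic: "lead_coeff p = 1" and deg: "degree p > 1"
    and depressed: "coeff p (degree p - 1) = 0" and k: "k < degree p" "coeff p k \<noteq> 0"
  obtains x y where "poly p x = 0" "poly p y = 0" "x \<noteq> y"
proof -
  obtain A where A: "size A = degree p" "p = smult (lead_coeff p) (\<Prod>x\<in>#A. [:- x, 1:])"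
    using alg_closed_imp_factorization[of p] deg by (metis degree_0 not_less_zero)
  obtain x where x: "poly p x = 0"
    using alg_closed_imp_poly_has_root[of p] deg by auto
  show ?thesis
  proof (cases "\<exists>y. poly p y = 0 \<and> x \<noteq> y")
    case True
    then show ?thesis using x that by blast
  next
    case False
    have "z = x" if "z \<in># A" for z
    proof -
      have "poly p z = (\<Prod>y\<in>#A. z - y)"
        by (subst A(2)) (simp add: monic poly_prod_mset)
      also have "\<dots> = 0"
        using that by auto
      finally show ?thesis using False by blast
    qed
    then have "A = replicate_mset (degree p) x"
      using A(1) set_mset_subset_singletonD[of A x] by auto
    then have p: "p = [:- x, 1:] ^ degree p"
      using A(2) by (simp add: monic)
    have "coeff p (degree p - 1) = of_nat (degree p) * - x"
    proof -
      have "degree p choose (degree p - 1) = degree p"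
        using deg binomial_symmetric[of "degree p - 1" "degree p"] by simp
      then have "coeff ([:- x, 1:] ^ degree p) (degree p - 1) = of_nat (degree p) * - x"
        using deg by (simp add: coeff_linear_poly_power)
      with p show ?thesis by metis
    qed
    with depressed deg have "x = 0" by auto
    then have "coeff p k = of_nat (degree p choose k) * 0 ^ (degree p - k)"
      using k(1) p coeff_linear_poly_power[of k "degree p" "- x" 1] by simp
    with k show ?thesis by simp
  qed
qed

text \<open>
  Substituting \<open>c * X\<close> for \<open>X\<close> is invertible, so factorizations can be transported back.
\<close>
lemma not_irreducible_if_rescaled_factors:
  fixes p :: "'a :: field poly"
  assumes "c \<noteq> 0" "d \<noteq> 0" "smult d (pcompose p [:0, c:]) = g * h" "degree g > 0" "degree h > 0"
  shows "\<not> irreducible p"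
proof -
  let ?l = "[:0, 1 / c:]"
  have "smult (1 / d) (pcompose (g * h) ?l) = pcompose p (pcompose [:0, c:] ?l)"
    using assms(2) by (simp add: assms(3)[symmetric] pcompose_smult pcompose_assoc)
  also have "pcompose [:0, c:] ?l = [:0, 1:]"
    using assms(1) by (simp add: pcompose_pCons)
  finally have "p = smult (1 / d) (pcompose g ?l) * pcompose h ?l"
    by (simp add: pcompose_mult)
  then show ?thesis
    by (rule reducible_polyI) (use assms in \<open>simp_all add: degree_pcompose\<close>)
qed

text \<open>
  Let \<open>\<rho>\<close> be the least slope \<open>ord a_i / (n - i)\<close> among the nonzero coefficients with \<open>i < n\<close>.
  Then \<open>q(X) = t^(-n\<rho>) p(t^\<rho> X)\<close> is monic with coefficients of order at least \<open>0\<close>, and order \<open>0\<close>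
  is attained below the leading term at an index where the slope is \<open>\<rho>\<close>. Hence the reduction
  \<open>q0\<close>, obtained by taking the coefficients of \<open>t^0\<close>, is not \<open>X^n\<close>. Since its coefficient at
  \<open>n - 1\<close> is still zero, it has two distinct roots and splits into coprime factors, and these lift
  to a factorization of \<open>q\<close>. The exponent \<open>\<rho>\<close> may be any real number, which is why no
  ramification has to be adjoined.
\<close>
lemma depressed_gpuiseux_poly_reducible:
  fixes p :: "gpuiseux poly"
  assumes deg: "degree p > 1" and monic: "lead_coeff p = 1"
    and depressed: "coeff p (degree p - 1) = 0" and p0: "coeff p 0 \<noteq> 0"
  shows "\<not> irreducible p"
proof -
  define n where "n = degree p"
  define I where "I = {i. i < n \<and> coeff p i \<noteq> 0}"
  have "finite I" "0 \<in> I"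
    using deg p0 by (auto simp: I_def n_def)
  have "\<forall>f :: gpuiseux. \<exists>v. f \<noteq> 0 \<longrightarrow> gp_coeff f v \<noteq> 0 \<and> vanishes_below v f"
    using gp_order_exists by metis
  then obtain ord where ord: "\<And>f. f \<noteq> 0 \<Longrightarrow> gp_coeff f (ord f) \<noteq> 0"
      "\<And>f. f \<noteq> 0 \<Longrightarrow> vanishes_below (ord f) f"
    by metis
  define slope where "slope i = ord (coeff p i) / real (n - i)" for i
  define \<rho> where "\<rho> = Min (slope ` I)"
  have "\<rho> \<in> slope ` I"
    unfolding \<rho>_def by (rule Min_in) (use \<open>finite I\<close> \<open>0 \<in> I\<close> in auto)
  then obtain k where k: "k \<in> I" "\<rho> = slope k"
    by blast
  have slope_ge: "\<rho> \<le> slope i" if "i \<in> I" for i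
    using that \<open>finite I\<close> by (simp add: \<rho>_def)
  define T where "T = gp_monom \<rho> 1"
  define q where "q = smult (gp_monom (- (real n * \<rho>)) 1) (pcompose p [:0, T:])"
  have deg_q: "degree q = n"
    by (simp add: q_def degree_pcompose T_def n_def)
  have coeff_q: "gp_coeff (coeff q i) \<gamma> = gp_coeff (coeff p i) (\<gamma> + (real n - real i) * \<rho>)" for i \<gamma>
  proof -
    have "gp_coeff (coeff q i) \<gamma> = gp_coeff (coeff p i) (\<gamma> - - (real n * \<rho>) - real i * \<rho>)"
      unfolding q_def coeff_smult coeff_pcompose_linear T_def gp_monom_power gp_coeff_simps by simp
    then show ?thesis by (simp add: algebra_simps)
  qed
  have q_lead: "coeff q n = 1"
    by (rule gp_eqI) (use monic in \<open>simp add: coeff_q n_def\<close>)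
  have q_neg: "gp_coeff (coeff q i) \<gamma> = 0" if "\<gamma> < 0" for i \<gamma>
  proof (cases "i \<in> I")
    case True
    then have "(real n - real i) * \<rho> \<le> ord (coeff p i)"
      using slope_ge[OF True] by (simp add: slope_def I_def field_simps)
    then show ?thesis
      using that True by (auto simp: coeff_q I_def intro!: vanishes_belowD[OF ord(2)])
  next
    case False
    then consider "i = n" | "i > n" | "coeff p i = 0"
      by (fastforce simp: I_def)
    then show ?thesis
      using that q_lead deg_q by cases (auto simp: coeff_q coeff_eq_0 n_def)
  qed
  define q0 where "q0 = map_poly (\<lambda>f. gp_coeff f 0) q"
  have coeff_q0: "coeff q0 i = gp_coeff (coeff q i) 0" for i
    by (simp add: q0_def coeff_map_poly)
  have deg_q0: "degree q0 = n"
    unfolding q0_def by (subst map_poly_degree_eq) (simp_all add: deg_q q_lead)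
  obtain x y where "poly q0 x = 0" "poly q0 y = 0" "x \<noteq> y"
  proof (rule depressed_poly_has_two_roots)
    show "lead_coeff q0 = 1" "degree q0 > 1" "coeff q0 (degree q0 - 1) = 0"
      using deg depressed by (simp_all add: deg_q0 coeff_q0 q_lead) (simp_all add: coeff_q n_def)
    show "k < degree q0"
      using k(1) by (simp add: deg_q0 I_def)
    have "(real n - real k) * \<rho> = ord (coeff p k)"
      using k by (simp add: slope_def I_def field_simps)
    then show "coeff q0 k \<noteq> 0"
      using k ord(1) by (simp add: coeff_q0 coeff_q I_def)
  qed
  then obtain r s where rs: "degree r > 0" "degree s > 0" "coprime r s" "q0 = r * s"
    using alg_closed_imp_poly_splits_coprime[of q0 x y] deg by (auto simp: deg_q0 n_def)
  have "degree r + degree s = n"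
    using deg_q0 rs by (metis degree_mult_eq degree_0 less_irrefl)
  have "\<exists>\<epsilon>>0. vanishes_below \<epsilon> (coeff (q - const_poly q0) i)" for i
    by (rule vanishes_below_pos[of "coeff (q - const_poly q0) i"])
       (use q_neg in \<open>auto simp: coeff_q0\<close>)
  then obtain \<epsilon> where \<epsilon>: "\<And>i. \<epsilon> i > 0" "\<And>i. vanishes_below (\<epsilon> i) (coeff (q - const_poly q0) i)"
    by metis
  define \<delta> where "\<delta> = Min (\<epsilon> ` {..n})"
  have "\<delta> > 0"
    using \<epsilon>(1) by (simp add: \<delta>_def)
  have "poly_vanishes_below \<delta> (q - const_poly (r * s))"
    unfolding poly_vanishes_below_def
  proof
    fix i
    show "vanishes_below \<delta> (coeff (q - const_poly (r * s)) i)"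
    proof (cases "i \<le> n")
      case True
      then have "\<delta> \<le> \<epsilon> i" by (simp add: \<delta>_def)
      with \<epsilon>(2)[of i] rs(4) show ?thesis
        using vanishes_below_mono by auto
    next
      case False
      then have "coeff (q - const_poly q0) i = 0"
        using deg_q deg_q0 by (simp add: coeff_eq_0)
      with rs(4) show ?thesis by simp
    qed
  qed
  moreover have "degree (q - const_poly (r * s)) < degree r + degree s"
    unfolding \<open>degree r + degree s = n\<close> rs(4)[symmetric]
  proof (rule degree_lessI)
    show "\<forall>i\<ge>n. coeff (q - const_poly q0) i = 0"
    proof (intro allI impI)
      fix i assume "n \<le> i"
      then show "coeff (q - const_poly q0) i = 0"
        by (cases "i = n") (simp_all add: q_lead coeff_q0 gp_monom_1 coeff_eq_0 deg_q)
    qed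
  qed (use deg in \<open>simp add: n_def\<close>)
  ultimately obtain g h where "q = g * h" "degree g = degree r" "degree h = degree s"
    using coprime_factorization_lifts[OF rs(3,1,2) \<open>\<delta> > 0\<close>] by blast
  then show ?thesis
    using rs(1,2) by (intro not_irreducible_if_rescaled_factors[of T "gp_monom (- (real n * \<rho>)) 1" p g h])
      (simp_all add: q_def T_def)
qed

text \<open>
  In characteristic zero a Tschirnhaus shift of the variable removes the second coefficient, so
  reducibility of all depressed polynomials with nonzero constant term suffices.
\<close>
instance gpuiseux :: alg_closed_field
  by (rule alg_closedI_reducible_coeff_deg_minus_one_eq_0) (rule depressed_gpuiseux_poly_reducible)

section \<open>The field as a record of operations\<close>

lemma gen_puiseux_ring_simps [simp]:
  "carrier gen_puiseux_ring = gen_puiseux_series"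
  "monoid.mult gen_puiseux_ring = puiseux_mult"
  "one gen_puiseux_ring = gp_coeff 1"
  "zero gen_puiseux_ring = gp_coeff 0"
  "add gen_puiseux_ring = (\<lambda>f g \<gamma>. f \<gamma> + g \<gamma>)"
  by (simp_all add: gen_puiseux_ring_def fun_eq_iff)

lemma gp_coeff_mult: "puiseux_mult (gp_coeff f) (gp_coeff g) = gp_coeff (f * g)"
  by transfer simp

lemma gp_coeff_add: "(\<lambda>\<gamma>. gp_coeff f \<gamma> + gp_coeff g \<gamma>) = gp_coeff (f + g)"
  by transfer simp

lemma gen_puiseux_seriesE:
  assumes "f \<in> gen_puiseux_series"
  obtains F where "f = gp_coeff F"
  using assms gp_coeff_cases by blast

lemma field_gen_puiseux_ring: "field gen_puiseux_ring"
proof (rule cring.cring_fieldI2)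
  show "cring gen_puiseux_ring"
  proof (rule cringI)
    show "abelian_group gen_puiseux_ring"
    proof (rule abelian_groupI)
      fix x assume "x \<in> carrier gen_puiseux_ring"
      then obtain F where "x = gp_coeff F"
        by (auto elim: gen_puiseux_seriesE)
      then show "\<exists>y\<in>carrier gen_puiseux_ring. y \<oplus>\<^bsub>gen_puiseux_ring\<^esub> x = \<zero>\<^bsub>gen_puiseux_ring\<^esub>"
        using gp_coeff[of "- F"] by (intro bexI[of _ "gp_coeff (- F)"]) (simp_all add: fun_eq_iff)
    qed (auto elim!: gen_puiseux_seriesE simp: gp_coeff gp_coeff_add add_ac)
    show "comm_monoid gen_puiseux_ring"
      by (rule comm_monoidI)
         (auto elim!: gen_puiseux_seriesE simp: gp_coeff gp_coeff_mult mult_ac)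
  qed (auto elim!: gen_puiseux_seriesE simp: gp_coeff gp_coeff_mult gp_coeff_add distrib_right)
  show "\<zero>\<^bsub>gen_puiseux_ring\<^esub> \<noteq> \<one>\<^bsub>gen_puiseux_ring\<^esub>"
    by (simp add: gp_coeff_inject)
  fix a assume "a \<in> carrier gen_puiseux_ring" "a \<noteq> \<zero>\<^bsub>gen_puiseux_ring\<^esub>"
  then obtain F where F: "a = gp_coeff F" "F \<noteq> 0"
    by (auto elim!: gen_puiseux_seriesE)
  then show "\<exists>b\<in>carrier gen_puiseux_ring. a \<otimes>\<^bsub>gen_puiseux_ring\<^esub> b = \<one>\<^bsub>gen_puiseux_ring\<^esub>"
    by (intro bexI[of _ "gp_coeff (inverse F)"]) (simp_all add: gp_coeff gp_coeff_mult)
qed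

text \<open>
  The list representation puts the leading coefficient first, whence the reversal.
\<close>
lemma eval_gen_puiseux_ring:
  "ring.eval gen_puiseux_ring (map gp_coeff cs) (gp_coeff x) = gp_coeff (poly (Poly (rev cs)) x)"
proof -
  interpret field gen_puiseux_ring
    by (rule field_gen_puiseux_ring)
  have pow: "gp_coeff x [^]\<^bsub>gen_puiseux_ring\<^esub> k = gp_coeff (x ^ k)" for k :: nat
    by (induction k) (simp_all add: gp_coeff_mult mult_ac)
  show ?thesis
    by (induction cs) (simp_all add: pow gp_coeff_mult gp_coeff_add Poly_append poly_monom mult_ac add_ac)
qed

theorem theorem6:
  shows "algebraically_closed gen_puiseux_ring"
proof -
  interpret field gen_puiseux_ring
    by (rule field_gen_puiseux_ring)
  show ?thesis
  proof (rule algebraically_closedI)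
    fix p assume p: "p \<in> carrier (poly_ring gen_puiseux_ring)" and deg: "Polynomials.degree p > 1"
    define cs where "cs = map Abs_gpuiseux p"
    have "set p \<subseteq> gen_puiseux_series" and "p \<noteq> []" and lead: "hd p \<noteq> gp_coeff 0"
      using p deg by (auto simp: univ_poly_def polynomial_def)
    then have p_eq: "p = map gp_coeff cs"
      by (auto simp: cs_def Abs_gpuiseux_inverse intro!: map_idI[symmetric])
    with lead \<open>p \<noteq> []\<close> have "coeffs (Poly (rev cs)) = rev cs"
      by (cases cs) auto
    then have "degree (Poly (rev cs)) = length p - 1"
      by (simp add: degree_eq_length_coeffs p_eq)
    with deg have "degree (Poly (rev cs)) > 0"
      by simp
    then obtain x where "poly (Poly (rev cs)) x = 0"
      using alg_closed_imp_poly_has_root by blast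
    then show "\<exists>x\<in>carrier gen_puiseux_ring. eval p x = \<zero>\<^bsub>gen_puiseux_ring\<^esub>"
      by (intro bexI[of _ "gp_coeff x"]) (simp_all add: p_eq eval_gen_puiseux_ring gp_coeff)
  qed
qed

end
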